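(* The following identity holds, with the series converging: $$\frac{e-\frac1e}{2}=\sum_{m=1}^\infty\frac{(-1)^{m+1}}{(2m+1)!}\sum_{j=0}^{m-1}(-1)^j\binom{2m-j}{j}\pi^{2m-2j},$$ that is, $$\frac{e-\frac{1}{e}}{2}=\frac{\pi^2}{3!}-\frac{\pi^4-3\pi^2}{5!}+\frac{\pi^6-5\pi^4+6\pi^2}{7!}-\frac{\pi^8-7\pi^6+15\pi^4-10\pi^2}{9!}+\cdots.$$ *)

theory Defs
  imports Complex_Main
begin

definition series_term :: "nat \<Rightarrow> real" where
  "series_term m =
     (-1) ^ (m + 1) / fact (2 * m + 1) *
       (\<Sum>j = 0..<m. (-1) ^ j * real ((2 * m - j) choose j) * pi ^ (2 * m - 2 * j))"

end

theory Submission
  imports Defs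
begin

text \<open>
  Completed by its missing summand \<open>j = m\<close>, the inner sum is \<open>U\<^sub>2\<^sub>m(\<pi>/2)\<close>, with \<open>U\<close> the Chebyshev
  polynomials of the second kind; the missing summands contribute \<open>\<Sum> 1/(2m+1)! = sinh 1\<close>. As
  \<open>\<pi> > 2\<close>, we can write \<open>\<pi> = a + b\<close> with \<open>a b = 1\<close> and \<open>a \<noteq> b\<close>, so that
  \<open>U\<^sub>2\<^sub>m(\<pi>/2) = (a\<^bsup>2m+1\<^esup> - b\<^bsup>2m+1\<^esup>)/(a - b)\<close>. The completed series is therefore
  \<open>(sin a - sin b)/(a - b)\<close>, which vanishes since \<open>b = \<pi> - a\<close>.
\<close>

text \<open>The Lucas sequence \<open>U\<close> with parameters \<open>x\<close>, \<open>y\<close>,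
  at index \<open>n + 1\<close>. Summands with \<open>2 * j > n\<close> have a zero binomial, so
  truncated subtraction does no harm.\<close>

definition lucas_sum :: "'a::comm_ring_1 \<Rightarrow> 'a \<Rightarrow> nat \<Rightarrow> 'a" where
  "lucas_sum x y n = (\<Sum>j\<le>n. of_nat ((n - j) choose j) * x ^ (n - 2 * j) * (- y) ^ j)"

text \<open>Pascal's rule, applied to each coefficient once the summand \<open>j = 0\<close> is
  split off.\<close>

lemma lucas_sum_rec:
  "lucas_sum x y (Suc (Suc n)) = x * lucas_sum x y (Suc n) - y * lucas_sum x y n"
proof -
  have shift: "lucas_sum x y (Suc n) = x ^ Suc n +
      (\<Sum>i\<le>n. of_nat ((n - i) choose Suc i) * x ^ (Suc n - 2 * Suc i) * (- y) ^ Suc i)"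
    unfolding lucas_sum_def by (subst sum.atMost_Suc_shift) simp
  \<comment> \<open>For \<open>2 * i >= n\<close> truncation makes the powers of \<open>x\<close>
    disagree, but the binomial is zero.\<close>
  have tail: "x * (of_nat ((n - i) choose Suc i) * x ^ (Suc n - 2 * Suc i) * (- y) ^ Suc i) =
      of_nat ((n - i) choose Suc i) * x ^ (n - 2 * i) * (- y) ^ Suc i" for i
  proof (cases "2 * i < n")
    case True
    then have "n - 2 * i = Suc (Suc n - 2 * Suc i)" by simp
    then show ?thesis by (simp only: power_Suc mult_ac)
  next
    case False
    then have "(n - i) choose Suc i = 0" by (intro binomial_eq_0) linarith
    then show ?thesis by (simp only: of_nat_0 mult_zero_left mult_zero_right)
  qed
  have pascal: "(Suc n - i) choose Suc i = ((n - i) choose Suc i) + ((n - i) choose i)" if "i \<le> n" for i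
    using that by (simp add: Suc_diff_le)
  have "lucas_sum x y (Suc (Suc n)) = x ^ Suc (Suc n) +
      (\<Sum>i\<le>Suc n. of_nat ((Suc n - i) choose Suc i) * x ^ (n - 2 * i) * (- y) ^ Suc i)"
    unfolding lucas_sum_def by (subst sum.atMost_Suc_shift) simp
  also have "\<dots> = x ^ Suc (Suc n) +
      (\<Sum>i\<le>n. of_nat ((Suc n - i) choose Suc i) * x ^ (n - 2 * i) * (- y) ^ Suc i)"
    by simp
  also have "\<dots> = x ^ Suc (Suc n) +
      ((\<Sum>i\<le>n. of_nat ((n - i) choose Suc i) * x ^ (n - 2 * i) * (- y) ^ Suc i) +
       (\<Sum>i\<le>n. of_nat ((n - i) choose i) * x ^ (n - 2 * i) * (- y) ^ Suc i))"
    unfolding sum.distrib [symmetric]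
    by (intro arg_cong2 [where f = "(+)"] refl sum.cong)
       (simp only: pascal atMost_iff of_nat_add distrib_right)
  also have "\<dots> = x * lucas_sum x y (Suc n) +
       (\<Sum>i\<le>n. of_nat ((n - i) choose i) * x ^ (n - 2 * i) * (- y) ^ Suc i)"
    unfolding shift distrib_left sum_distrib_left tail by (simp add: add.assoc)
  also have "(\<Sum>i\<le>n. of_nat ((n - i) choose i) * x ^ (n - 2 * i) * (- y) ^ Suc i) =
       - y * lucas_sum x y n"
    unfolding lucas_sum_def sum_distrib_left by (intro sum.cong refl) (simp add: mult_ac)
  finally show ?thesis by simp
qed

text \<open>Both sides obey the recurrence whose characteristic roots are \<open>a\<close> and
  \<open>b\<close>. The factor \<open>a - b\<close> avoids division, so any commutative ring will
  do.\<close>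

lemma lucas_sum_binet: "(a - b) * lucas_sum (a + b) (a * b) n = a ^ Suc n - b ^ Suc n"
proof (induction n rule: induct_nat_012)
  case 0
  show ?case by (simp add: lucas_sum_def)
next
  case 1
  show ?case by (simp add: lucas_sum_def algebra_simps)
next
  case (ge2 n)
  have "(a - b) * lucas_sum (a + b) (a * b) (Suc (Suc n)) =
      (a + b) * ((a - b) * lucas_sum (a + b) (a * b) (Suc n)) -
      a * b * ((a - b) * lucas_sum (a + b) (a * b) n)"
    by (simp add: lucas_sum_rec algebra_simps)
  also have "\<dots> = a ^ Suc (Suc (Suc n)) - b ^ Suc (Suc (Suc n))"
    unfolding ge2 by (simp add: algebra_simps)
  finally show ?case .
qed

lemma series_term_eq:
  "series_term m = 1 / fact (2 * m + 1) - (-1) ^ m / fact (2 * m + 1) * lucas_sum pi 1 (2 * m)"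
proof -
  let ?f = "\<lambda>j. (-1) ^ j * real ((2 * m - j) choose j) * pi ^ (2 * m - 2 * j)"
  have "lucas_sum pi 1 (2 * m) = (\<Sum>j\<le>2 * m. ?f j)"
    unfolding lucas_sum_def by (intro sum.cong refl) (simp add: mult_ac)
  also have "\<dots> = (\<Sum>j\<le>m. ?f j)"
    by (rule sum.mono_neutral_right) auto
  \<comment> \<open>The summand \<open>j = m\<close> is \<open>(-1) ^ m\<close>, as
    \<open>m choose m\<close> and \<open>pi ^ 0\<close> are 1.\<close>
  also have "\<dots> = (\<Sum>j = 0..<m. ?f j) + (-1) ^ m"
    by (simp add: atLeast0LessThan flip: lessThan_Suc_atMost)
  finally have "(\<Sum>j = 0..<m. ?f j) = lucas_sum pi 1 (2 * m) - (-1) ^ m"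
    by simp
  then have "series_term m =
      (-1) ^ (m + 1) / fact (2 * m + 1) * (lucas_sum pi 1 (2 * m) - (-1) ^ m)"
    by (simp only: series_term_def)
  also have "\<dots> = ((-1) ^ m * (-1) ^ m) / fact (2 * m + 1) -
      (-1) ^ m / fact (2 * m + 1) * lucas_sum pi 1 (2 * m)"
    by (simp add: right_diff_distrib diff_divide_distrib del: fact_Suc)
  also have "(-1) ^ m * (-1) ^ m = (1 :: real)"
    by (simp flip: power_mult_distrib)
  finally show ?thesis .
qed

text \<open>In each pair of consecutive terms of the power series only the odd one survives.\<close>

lemma sin_sums_odd: "(\<lambda>m. (-1) ^ m / fact (2 * m + 1) * x ^ (2 * m + 1)) sums sin (x :: real)"
proof -
  have "(\<lambda>m. \<Sum>n = m * 2..<m * 2 + 2. sin_coeff n * x ^ n) sums sin x"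
    using sums_group [OF sin_converges [of x], of 2] by simp
  then show ?thesis
    by (simp add: sin_coeff_def mult.commute del: fact_Suc)
qed

lemma sinh_sums_odd: "(\<lambda>m. x ^ (2 * m + 1) / fact (2 * m + 1)) sums sinh (x :: real)"
proof -
  have "(\<lambda>m. \<Sum>n = m * 2..<m * 2 + 2. if even n then 0 else x ^ n /\<^sub>R fact n) sums sinh x"
    using sums_group [OF sinh_converges [of x], of 2] by simp
  then show ?thesis
    by (simp add: mult.commute divide_inverse del: fact_Suc)
qed

lemma lucas_sum_pi_sums_0:
  "(\<lambda>m. (-1) ^ m / fact (2 * m + 1) * lucas_sum pi 1 (2 * m)) sums 0"
proof -
  \<comment> \<open>\<open>a\<close> and \<open>b\<close> will be the roots of
    \<open>t^2 - pi * t + 1\<close>, with discriminant \<open>d^2\<close>.\<close>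
  define d where "d = sqrt (pi\<^sup>2 - 4)"
  define a where "a = (pi + d) / 2"
  define b where "b = (pi - d) / 2"
  \<comment> \<open>From \<open>sin x \<le> x\<close> at \<open>pi / 6\<close>, where the sine is
    1/2; this makes the discriminant positive.\<close>
  have "3 \<le> pi"
    using sin_x_le_x [of "pi / 6"] by (simp add: sin_30)
  then have "2\<^sup>2 < pi\<^sup>2"
    by (intro power_strict_mono) auto
  then have "d\<^sup>2 = pi\<^sup>2 - 4" "d > 0"
    by (auto simp: d_def)
  then have ab: "a + b = pi" "a * b = 1" "a - b \<noteq> 0"
    by (auto simp: a_def b_def field_simps power2_eq_square)
  have binet: "lucas_sum pi 1 n = (a ^ Suc n - b ^ Suc n) / (a - b)" for n
    using lucas_sum_binet [of a b n] ab by (simp add: field_simps)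
  have "sin b = sin a"
    using sin_pi_minus [of a] unfolding ab(1) [symmetric] by simp
  then have "(\<lambda>m. ((-1) ^ m / fact (2 * m + 1) * a ^ (2 * m + 1) -
      (-1) ^ m / fact (2 * m + 1) * b ^ (2 * m + 1)) / (a - b)) sums 0"
    using sums_divide [OF sums_diff [OF sin_sums_odd [of a] sin_sums_odd [of b]], of "a - b"]
    by simp
  then show ?thesis
    by (simp add: binet right_diff_distrib del: fact_Suc)
qed

theorem theorem3:
  shows "(\<lambda>n. series_term (Suc n)) sums ((exp 1 - 1 / exp 1) / 2)
    \<and> series_term 1 = pi ^ 2 / fact 3
    \<and> series_term 2 = - ((pi ^ 4 - 3 * pi ^ 2) / fact 5)
    \<and> series_term 3 = (pi ^ 6 - 5 * pi ^ 4 + 6 * pi ^ 2) / fact 7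
    \<and> series_term 4 = - ((pi ^ 8 - 7 * pi ^ 6 + 15 * pi ^ 4 - 10 * pi ^ 2) / fact 9)"
proof (intro conjI)
  have "(\<lambda>m. 1 / fact (2 * m + 1) - (-1) ^ m / fact (2 * m + 1) * lucas_sum pi 1 (2 * m))
      sums (sinh 1 - 0)"
    using sums_diff [OF sinh_sums_odd [of 1] lucas_sum_pi_sums_0] by (simp del: fact_Suc)
  then have "series_term sums ((exp 1 - 1 / exp 1) / 2)"
    by (simp only: series_term_eq [symmetric] sinh_field_def exp_minus inverse_eq_divide diff_zero)
  \<comment> \<open>The inner sum is empty, so starting at index 1 leaves the total
    unchanged.\<close>
  moreover have "series_term 0 = 0"
    by (simp add: series_term_def)
  ultimately show "(\<lambda>n. series_term (Suc n)) sums ((exp 1 - 1 / exp 1) / 2)"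
    by (subst sums_Suc_iff) simp
next
  show "series_term 1 = pi ^ 2 / fact 3"
    by (simp add: series_term_def)
  have "{0..<2} = {0, 1 :: nat}"
    by auto
  then show "series_term 2 = - ((pi ^ 4 - 3 * pi ^ 2) / fact 5)"
    by (simp add: series_term_def)
  have "{0..<3} = {0, 1, 2 :: nat}"
    by auto
  then show "series_term 3 = (pi ^ 6 - 5 * pi ^ 4 + 6 * pi ^ 2) / fact 7"
    by (simp add: series_term_def choose_two)
  have "{0..<4} = {0, 1, 2, 3 :: nat}"
    by auto
  \<comment> \<open>The only binomial here that \<open>choose_two\<close> and simplification leave
    open.\<close>
  moreover have "5 choose 3 = (10 :: nat)"
    by (simp add: eval_nat_numeral)
  ultimately show "series_term 4 = - ((pi ^ 8 - 7 * pi ^ 6 + 15 * pi ^ 4 - 10 * pi ^ 2) / fact 9)"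
    by (simp add: series_term_def choose_two)
qed

end
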